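(* Let $n,k,m$ be positive integers with $m\mid k$, $\gcd(m,k/m)=1$ and $\mathrm{rad}(k/m)=\mathrm{rad}(n)>1$. Let $S$ be a sequence of $2n-2$ integers, none of which is divisible by $n$. Then $S$ has no subsequence of length at most $n$ whose sum is divisible by $n$ but not by $nk$ if and only if there exist integers $c,d$ with $c$ coprime to $n$ such that $n-1$ terms of $S$ are congruent to $d\frac{nk}{m}+cm$ modulo $nk$ and the other $n-1$ terms of $S$ are congruent to $-d\frac{nk}{m}-cm$ modulo $nk$. In fact, such a sequence $S$ (i.e. one satisfying these equivalent conditions) has no subsequence (of any length) whose sum is divisible by $n$ but not by $nk$.
   Context: For a positive integer $n$, $\mathrm{rad}(n)=\prod_{p\mid n}p$ is the product of the distinct prime divisors of $n$, with $\mathrm{rad}(1)=1$. Sequences are finite and unordered with repetition allowed (multisets); a subsequence is a sub-multiset, and its length is the number of its terms counted with multiplicity. *)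

theory Defs
  imports "HOL-Library.Multiset" "HOL-Number_Theory.Number_Theory"
begin

definition rad :: "nat \<Rightarrow> nat" where
  "rad n = (\<Prod>p\<in>prime_factors n. p)"

end

theory Submission
  imports Defs
begin

text \<open>
  Any sequence of at least \<open>n\<close> integers contains a short zero-sum modulo \<open>n\<close>, so the
  hypothesis on short subsequences already forces every subsequence sum divisible by \<open>n\<close> to be
  divisible by \<open>nk\<close>. Suppose that \<open>x\<close> is a term and \<open>U\<close>, \<open>V\<close> are disjoint subsequences avoiding it
  whose sets of subset sums modulo \<open>n\<close> are both invariant under translation by \<open>x\<close>. Pairing
  subset sums of \<open>U\<close> with opposite ones of \<open>V\<close> shows that a subset sum of \<open>U\<close> congruent to \<open>jx\<close>
  modulo \<open>n\<close> is congruent to \<open>jx\<close> modulo \<open>nk\<close>; taking for \<open>j\<close> the order of \<open>x\<close> modulo \<open>n\<close>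
  contradicts that every prime divisor of \<open>n\<close> divides \<open>k\<close>. Hence, distributing the terms one by one
  over \<open>U\<close> and \<open>V\<close>, the total number of subset sums can be made to grow at every step. It starts at \<open>2\<close>
  and cannot exceed \<open>2n\<close>, so with \<open>2n - 2\<close> terms it grows by exactly one each time. Two terms
  \<open>x \<noteq> \<plusminus>y\<close> modulo \<open>n\<close> put together at the start would yield four subset sums, one too many; thus
  all terms agree up to sign modulo \<open>n\<close>, they are coprime to \<open>n\<close>, and the remaining claims follow by
  exchanging terms.
\<close>

section \<open>Subset sums, lifting, and short zero-sums\<close>

definition subsums :: "int \<Rightarrow> int multiset \<Rightarrow> int set" where
  "subsums n V = {sum_mset T mod n | T. T \<subseteq># V}"

text \<open>The length bound of the theorem is dropped, because the unions and exchanges below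
  produce subsequences of any length. \<open>zero_lifting_if_short\<close> shows that the bounded
  condition already gives this.\<close>

definition zero_lifting :: "int \<Rightarrow> int \<Rightarrow> int multiset \<Rightarrow> bool" where
  "zero_lifting n k S \<longleftrightarrow> (\<forall>T. T \<subseteq># S \<longrightarrow> n dvd sum_mset T \<longrightarrow> n * k dvd sum_mset T)"

lemma zero_liftingD:
  "zero_lifting n k S \<Longrightarrow> T \<subseteq># S \<Longrightarrow> n dvd sum_mset T \<Longrightarrow> n * k dvd sum_mset T"
  by (simp add: zero_lifting_def)

text \<open>Pigeonhole on the \<open>n + 1\<close> prefix sums of lengths \<open>0\<close> to
  \<open>n\<close>: two agree modulo \<open>n\<close>, and the terms between them form the
  subsequence.\<close>

lemma ex_short_zero_sum:
  fixes n :: nat and T :: "int multiset"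
  assumes "n > 0" "size T \<ge> n"
  obtains T' where "T' \<subseteq># T" "T' \<noteq> {#}" "size T' \<le> n" "int n dvd sum_mset T'"
proof -
  obtain xs where xs: "T = mset xs" by (metis ex_mset)
  define f where "f i = sum_list (take i xs) mod int n" for i
  have "f ` {0..n} \<subseteq> {0..<int n}" using assms by (auto simp: f_def)
  then have "card (f ` {0..n}) \<le> n"
    using card_mono[of "{0..<int n}" "f ` {0..n}"] by simp
  then have "\<not> inj_on f {0..n}" using card_image[of f "{0..n}"] by fastforce
  then obtain i j where ij: "i < j" "j \<le> n" "f i = f j"
    unfolding inj_on_def by (metis atLeastAtMost_iff linorder_neqE_nat)
  define ys where "ys = drop i (take j xs)"
  have split: "take j xs = take i xs @ ys"
    unfolding ys_def using ij(1) by (metis append_take_drop_id min.absorb1 less_imp_le take_take)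
  have "xs = take i xs @ ys @ drop j xs" using split by (metis append.assoc append_take_drop_id)
  then have "T = mset (take i xs) + mset ys + mset (drop j xs)"
    unfolding xs by (metis mset_append add.assoc)
  then have sub: "mset ys \<subseteq># T"
    by (metis mset_subset_eq_add_left mset_subset_eq_add_right subset_mset.order_trans)
  have len: "length ys = j - i" using ij assms unfolding ys_def xs by simp
  have "sum_list (take j xs) - sum_list (take i xs) = sum_list ys" by (simp add: split)
  then have dvd: "int n dvd sum_mset (mset ys)"
    using ij(3) by (metis f_def mod_eq_dvd_iff sum_mset_sum_list)
  have "length ys \<le> n" "ys \<noteq> []" using len ij by auto
  then show ?thesis using that[of "mset ys"] sub dvd by simp
qed

text \<open>Strong induction on the length: a long zero-sum modulo \<open>n\<close> splits into a
  short nonempty one and a smaller remainder, and both sums are divisible by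
  \<open>n * k\<close>.\<close>

lemma zero_lifting_if_short:
  fixes n k :: nat
  assumes "n > 0"
    and short: "\<And>T. T \<subseteq># S \<Longrightarrow> size T \<le> n \<Longrightarrow> int n dvd sum_mset T \<Longrightarrow> int n * int k dvd sum_mset T"
  shows "zero_lifting (int n) (int k) S"
proof -
  have "int n * int k dvd sum_mset T" if "T \<subseteq># S" "int n dvd sum_mset T" for T
    using that
  proof (induction "size T" arbitrary: T rule: less_induct)
    case less
    show ?case
    proof (cases "size T \<le> n")
      case True then show ?thesis using short less.prems by blast
    next
      case False
      then obtain T' where T': "T' \<subseteq># T" "T' \<noteq> {#}" "size T' \<le> n" "int n dvd sum_mset T'"
        using ex_short_zero_sum[OF \<open>n > 0\<close>, of T] by auto
      obtain R where R: "T = T' + R" using T'(1) by (metis subset_mset.add_diff_inverse)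
      have 1: "int n * int k dvd sum_mset T'"
        using short T' less.prems by (meson subset_mset.order_trans)
      have "int n dvd sum_mset R" using less.prems(2) T'(4) R by (simp add: dvd_add_right_iff)
      moreover have "R \<subseteq># S" using R less.prems(1) by (metis mset_subset_eq_add_right subset_mset.order_trans)
      moreover have "size R < size T" using R T'(2) by (simp add: nonempty_has_size)
      ultimately have "int n * int k dvd sum_mset R" using less.hyps by blast
      then show ?thesis using 1 R by simp
    qed
  qed
  then show ?thesis by (simp add: zero_lifting_def)
qed

section \<open>Growth of the sets of subset sums\<close>

lemma subsums_subset: "n > 0 \<Longrightarrow> subsums n V \<subseteq> {0..<n}"
  by (auto simp: subsums_def)

lemma finite_subsums: "n > 0 \<Longrightarrow> finite (subsums n V)"
  using finite_subset[OF subsums_subset] by blast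

lemma card_subsums_le: "n > 0 \<Longrightarrow> card (subsums n V) \<le> nat n"
  using card_mono[OF _ subsums_subset, of n V] by simp

lemma subsums_empty: "subsums n {#} = {0}"
  by (simp add: subsums_def)

lemma zero_in_subsums: "0 \<in> subsums n V"
  unfolding subsums_def by (auto intro!: exI[of _ "{#}"])

lemma subsums_mono: "V \<subseteq># W \<Longrightarrow> subsums n V \<subseteq> subsums n W"
  unfolding subsums_def using subset_mset.order_trans by blast

lemma subsums_add_mset_shift: "r \<in> subsums n V \<Longrightarrow> (r + x) mod n \<in> subsums n (add_mset x V)"
proof -
  assume "r \<in> subsums n V"
  then obtain T where "T \<subseteq># V" "r = sum_mset T mod n" by (auto simp: subsums_def)
  then have "add_mset x T \<subseteq># add_mset x V" "(r + x) mod n = sum_mset (add_mset x T) mod n"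
    by (simp_all add: mod_simps add.commute)
  then show ?thesis unfolding subsums_def by blast
qed

lemma card_subsums_add_mset_less:
  assumes "n > 0" "r \<in> subsums n V" "(r + x) mod n \<notin> subsums n V"
  shows "card (subsums n V) < card (subsums n (add_mset x V))"
proof (rule psubset_card_mono)
  show "finite (subsums n (add_mset x V))" using finite_subsums assms(1) by blast
  show "subsums n V \<subset> subsums n (add_mset x V)"
    using subsums_add_mset_shift[OF assms(2)] assms(3) subsums_mono[of V "add_mset x V"] by auto
qed

text \<open>Starting from the empty sum \<open>0\<close>, each use of the invariance adds
  \<open>x\<close> once.\<close>

lemma subsums_multiples:
  assumes "\<And>r. r \<in> subsums n V \<Longrightarrow> (r + x) mod n \<in> subsums n V"
  shows "\<exists>T. T \<subseteq># V \<and> sum_mset T mod n = (int j * x) mod n"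
proof -
  have "(int j * x) mod n \<in> subsums n V"
  proof (induction j)
    case 0 then show ?case by (simp add: zero_in_subsums)
  next
    case (Suc j)
    then show ?case using assms[OF Suc] by (simp add: algebra_simps mod_simps)
  qed
  then show ?thesis by (auto simp: subsums_def)
qed

text \<open>The witness is the order \<open>d = n / gcd n x\<close> of \<open>x\<close> modulo
  \<open>n\<close>. Here \<open>d * x = n * y\<close> with \<open>y\<close> coprime to
  \<open>d\<close>, whereas a prime factor of \<open>d > 1\<close> divides \<open>n\<close> and so
  \<open>k\<close>; hence \<open>k\<close> cannot divide \<open>y\<close>.\<close>

lemma not_dvd_multiple_of_order:
  fixes n k x :: int
  assumes "n > 0" and primes: "\<And>p. prime p \<Longrightarrow> p dvd n \<Longrightarrow> p dvd k" and "\<not> n dvd x"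
  obtains d :: nat where "n dvd int d * x" "\<not> n * k dvd int d * x"
proof -
  define g where "g = gcd n x"
  have "g > 0" using assms(1) by (simp add: g_def)
  obtain d y where dy: "n = g * d" "x = g * y" "coprime d y"
    using gcd_coprime_exists[of n x] \<open>g > 0\<close> unfolding g_def by (metis mult.commute less_irrefl)
  have "d > 0" using dy(1) assms(1) \<open>g > 0\<close> by (simp add: zero_less_mult_iff)
  have "d \<noteq> 1" using dy assms(3) by auto
  then obtain p where p: "prime p" "p dvd d"
    using \<open>d > 0\<close> prime_divisor_exists[of d] by auto
  have dx: "d * x = n * y" using dy by simp
  have "\<not> k dvd y"
  proof
    assume "k dvd y"
    then have "p dvd y" using primes[of p] p dy(1) by (meson dvd_mult dvd_trans)
    then show False using p dy(3) by (meson coprime_common_divisor not_prime_unit)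
  qed
  then have "\<not> n * k dvd d * x" unfolding dx using assms(1) by simp
  then show ?thesis using that[of "nat d"] \<open>d > 0\<close> dx by simp
qed

lemma not_both_subsums_invariant:
  fixes n k x :: int
  assumes "n > 0" and primes: "\<And>p. prime p \<Longrightarrow> p dvd n \<Longrightarrow> p dvd k"
    and S: "zero_lifting n k S" "add_mset x (U + V) \<subseteq># S" and "\<not> n dvd x"
    and U: "\<And>r. r \<in> subsums n U \<Longrightarrow> (r + x) mod n \<in> subsums n U"
    and V: "\<And>r. r \<in> subsums n V \<Longrightarrow> (r + x) mod n \<in> subsums n V"
  shows False
proof -
  obtain T where T: "\<And>j. T j \<subseteq># U" "\<And>j. sum_mset (T j) mod n = (int j * x) mod n"
    using subsums_multiples[of n U x, OF U] by metis
  have "\<exists>W. W \<subseteq># V \<and> sum_mset W mod n = (- (int j * x)) mod n" for j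
  proof -
    obtain W where W: "W \<subseteq># V" "sum_mset W mod n = (int ((nat n - 1) * j) * x) mod n"
      using subsums_multiples[of n V x, OF V] by metis
    \<comment> \<open>invariance gives only nonnegative multiples of \<open>x\<close>, and \<open>- j\<close> is \<open>(n - 1) * j\<close> modulo \<open>n\<close>\<close>
    have "int (nat n - 1) = n - 1" using assms(1) by simp
    then have "int ((nat n - 1) * j) * x = (n - 1) * int j * x" by (simp only: of_nat_mult)
    also have "\<dots> = - (int j * x) + n * (int j * x)" by (simp add: algebra_simps)
    finally have "int ((nat n - 1) * j) * x = - (int j * x) + n * (int j * x)" .
    then have "sum_mset W mod n = (- (int j * x)) mod n" using W(2) by (simp only: mod_mult_self2)
    then show ?thesis using W(1) by blast
  qed
  then obtain W where W: "\<And>j. W j \<subseteq># V" "\<And>j. sum_mset (W j) mod n = (- (int j * x)) mod n"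
    by metis
  have cong: "[sum_mset (T i) + sum_mset (W j) = int i * x + - (int j * x)] (mod n)" for i j
    by (rule cong_add) (simp_all only: cong_def T W)
  have "[sum_mset (T j) = int j * x] (mod n * k)" for j
  proof (induction j)
    case 0
    \<comment> \<open>\<open>T 0\<close> need not be empty: its sum is only known to vanish modulo
      \<open>n\<close>, and lifting gives the rest.\<close>
    have "T 0 \<subseteq># S" using T(1)[of 0] S(2)
      by (metis add_mset_add_single mset_subset_eq_add_left subset_mset.order_trans)
    then show ?case using zero_liftingD[OF S(1)] T(2)[of 0] by (simp add: cong_0_iff mod_eq_0_iff_dvd)
  next
    case (Suc j)
    \<comment> \<open>Both \<open>T (Suc j) + W (Suc j)\<close> and \<open>x\<close> together with
      \<open>T j + W (Suc j)\<close> are zero-sums modulo \<open>n\<close>, hence modulo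
      \<open>n * k\<close>; in the difference \<open>W\<close> cancels.\<close>
    have A: "T (Suc j) + W (Suc j) \<subseteq># U + V" using T W by (simp add: subset_mset.add_mono)
    then have A': "T (Suc j) + W (Suc j) \<subseteq># S" using S(2)
      by (metis add_mset_add_single mset_subset_eq_add_left subset_mset.order_trans)
    have "n dvd sum_mset (T (Suc j)) + sum_mset (W (Suc j))"
      using cong[of "Suc j" "Suc j"] by (simp add: cong_0_iff)
    then have 1: "n * k dvd sum_mset (T (Suc j)) + sum_mset (W (Suc j))"
      using zero_liftingD[OF S(1) A'] by simp
    have "add_mset x (T j + W (Suc j)) \<subseteq># add_mset x (U + V)" using T W by (simp add: subset_mset.add_mono)
    then have B: "add_mset x (T j + W (Suc j)) \<subseteq># S" using S(2) by (meson subset_mset.order_trans)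
    have "[x + (sum_mset (T j) + sum_mset (W (Suc j))) = x + (int j * x + - (int (Suc j) * x))] (mod n)"
      by (rule cong_add[OF cong_refl cong])
    then have "n dvd x + (sum_mset (T j) + sum_mset (W (Suc j)))"
      by (simp add: algebra_simps cong_0_iff)
    then have "n * k dvd x + (sum_mset (T j) + sum_mset (W (Suc j)))"
      using zero_liftingD[OF S(1) B] by simp
    then have "n * k dvd sum_mset (T (Suc j)) - (x + sum_mset (T j))"
      using dvd_diff[OF 1, of "x + (sum_mset (T j) + sum_mset (W (Suc j)))"] by (simp add: algebra_simps)
    then have "[sum_mset (T (Suc j)) = x + sum_mset (T j)] (mod n * k)" by (simp add: cong_iff_dvd_diff)
    also have "[x + sum_mset (T j) = x + int j * x] (mod n * k)"
      using Suc by (simp add: cong_add_lcancel)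
    finally show ?case by (simp add: algebra_simps)
  qed
  \<comment> \<open>For this \<open>d\<close> the sum of \<open>T d\<close> vanishes modulo
    \<open>n\<close>, hence modulo \<open>n * k\<close>, yet it is congruent to
    \<open>d * x\<close>, which does not.\<close>
  moreover obtain d :: nat where d: "n dvd int d * x" "\<not> n * k dvd int d * x"
    using not_dvd_multiple_of_order assms(1,5) primes by metis
  moreover have "n * k dvd sum_mset (T d)"
  proof (rule zero_liftingD[OF S(1)])
    show "T d \<subseteq># S" using T(1)[of d] S(2)
      by (metis add_mset_add_single mset_subset_eq_add_left subset_mset.order_trans)
    show "n dvd sum_mset (T d)" using T(2)[of d] d(1) by (metis mod_eq_0_iff_dvd)
  qed
  ultimately show False by (meson cong_dvd_iff)
qed

text \<open>Each term of \<open>W\<close> joins a side whose subset sums are not invariant under it;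
  \<open>not_both_subsums_invariant\<close> provides one. The start \<open>U0\<close>,
  \<open>V0\<close> is left free so that a surplus there persists to the end.\<close>

lemma subsums_growth:
  fixes n k :: int
  assumes "n > 0" and primes: "\<And>p. prime p \<Longrightarrow> p dvd n \<Longrightarrow> p dvd k"
    and S: "zero_lifting n k S" and nz: "\<forall>x\<in>#S. \<not> n dvd x"
    and sub: "U0 + V0 + W \<subseteq># S"
  obtains U V where "U + V = U0 + V0 + W"
    "card (subsums n U) + card (subsums n V) \<ge> card (subsums n U0) + card (subsums n V0) + size W"
  using sub
proof (induction W arbitrary: thesis)
  case empty
  then show ?case by fastforce
next
  case (add x W)
  have "U0 + V0 + W \<subseteq># S" using add.prems(2)
    by (metis mset_subset_eq_insertD subset_mset.less_imp_le union_mset_add_mset_right)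
  with add.IH obtain U V where UV: "U + V = U0 + V0 + W"
    "card (subsums n U) + card (subsums n V) \<ge> card (subsums n U0) + card (subsums n V0) + size W"
    by metis
  have xS: "add_mset x (U + V) \<subseteq># S" using add.prems(2) UV(1) by simp
  have x: "\<not> n dvd x" using nz mset_subset_eqD[OF xS] by simp
  show ?case
  proof (cases "\<exists>r\<in>subsums n U. (r + x) mod n \<notin> subsums n U")
    case True
    then have "card (subsums n U) < card (subsums n (add_mset x U))"
      using card_subsums_add_mset_less[OF assms(1)] by blast
    then show ?thesis using add.prems(1)[of "add_mset x U" V] UV by simp
  next
    case False
    then have "\<exists>r\<in>subsums n V. (r + x) mod n \<notin> subsums n V"
      using not_both_subsums_invariant[OF assms(1) primes S xS x] by blast
    then have "card (subsums n V) < card (subsums n (add_mset x V))"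
      using card_subsums_add_mset_less[OF assms(1)] by blast
    then show ?thesis using add.prems(1)[of U "add_mset x V"] UV by simp
  qed
qed

text \<open>The second side starts empty and contributes the \<open>1\<close>, its only subset sum
  being \<open>0\<close>; at the end each side has at most \<open>n\<close> subset sums.\<close>

lemma card_subsums_bound:
  fixes n k :: int
  assumes "n > 0" and primes: "\<And>p. prime p \<Longrightarrow> p dvd n \<Longrightarrow> p dvd k"
    and "zero_lifting n k S" and "\<forall>x\<in>#S. \<not> n dvd x" and sub: "U0 \<subseteq># S"
  shows "card (subsums n U0) + 1 + size (S - U0) \<le> 2 * nat n"
proof -
  have "U0 + {#} + (S - U0) \<subseteq># S" using sub by simp
  from subsums_growth[OF assms(1) primes assms(3,4) this]
  obtain U V where
    "card (subsums n U) + card (subsums n V) \<ge> card (subsums n U0) + card (subsums n {#}) + size (S - U0)"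
    by metis
  then show ?thesis
    using card_subsums_le[OF assms(1), of U] card_subsums_le[OF assms(1), of V] by (simp add: subsums_empty)
qed

section \<open>Terms up to sign, and their coprimality to \<open>n\<close>\<close>

lemma card_subsums_pair:
  fixes n x y :: int
  assumes "n > 0" "\<not> n dvd x" "\<not> n dvd y" "\<not> n dvd x - y" "\<not> n dvd x + y"
  shows "card (subsums n {#x, y#}) \<ge> 4"
proof -
  have sub: "{0, x mod n, y mod n, (x + y) mod n} \<subseteq> subsums n {#x, y#}"
    unfolding subsums_def
    by (auto intro: exI[of _ "{#}"] exI[of _ "{#x#}"] exI[of _ "{#y#}"] exI[of _ "{#x, y#}"])
  have "card {0, x mod n, y mod n, (x + y) mod n} = 4"
    using assms by (simp add: mod_eq_dvd_iff card_insert_if dvd_diff_commute flip: dvd_eq_mod_eq_0)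
  then show ?thesis using card_mono[OF finite_subsums[OF assms(1)] sub] by simp
qed

lemma pair_subset_mset: "x \<in># S \<Longrightarrow> y \<in># S \<Longrightarrow> x \<noteq> y \<Longrightarrow> {#x, y#} \<subseteq># S"
  by (simp add: insert_subset_eq_iff in_diff_count)

text \<open>Otherwise \<open>{#x, y#}\<close> has four subset sums, and
  \<open>card_subsums_bound\<close> would give
  \<open>4 + 1 + (2 * n - 4) \<le> 2 * n\<close>.\<close>

lemma terms_equal_up_to_sign:
  fixes n k :: int
  assumes "n > 0" and primes: "\<And>p. prime p \<Longrightarrow> p dvd n \<Longrightarrow> p dvd k"
    and "zero_lifting n k S" and nz: "\<forall>x\<in>#S. \<not> n dvd x" and "size S + 2 = 2 * nat n"
    and "x \<in># S" "y \<in># S"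
  shows "n dvd x - y \<or> n dvd x + y"
proof (rule ccontr)
  assume neg: "\<not> ?thesis"
  then have "x \<noteq> y" by auto
  then have sub: "{#x, y#} \<subseteq># S" using assms(6,7) by (intro pair_subset_mset)
  have "size (S - {#x, y#}) + 2 = size S"
    using size_mset_mono[OF sub] size_Diff_submset[OF sub] by simp
  moreover have "card (subsums n {#x, y#}) \<ge> 4" using card_subsums_pair assms neg by blast
  ultimately show False using card_subsums_bound[OF assms(1) primes assms(3,4) sub] assms(5) by simp
qed

text \<open>Growth from two empty sides reaches \<open>2 * n\<close>, so both sides attain the
  maximum \<open>n\<close> and \<open>1\<close> is a subset sum modulo \<open>n\<close>. All terms
  are \<open>g\<close> or \<open>- g\<close> modulo \<open>n\<close>, so a common divisor of
  \<open>g\<close> and \<open>n\<close> divides this sum and hence \<open>1\<close>.\<close>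

lemma terms_coprime:
  fixes n k :: int
  assumes "n > 0" and primes: "\<And>p. prime p \<Longrightarrow> p dvd n \<Longrightarrow> p dvd k"
    and S: "zero_lifting n k S" and nz: "\<forall>x\<in>#S. \<not> n dvd x" and size: "size S + 2 = 2 * nat n"
    and "g \<in># S"
  shows "coprime g n"
proof (rule coprimeI)
  fix e assume e: "e dvd g" "e dvd n"
  have "{#} + {#} + S \<subseteq># S" by simp
  from subsums_growth[OF assms(1) primes S nz this] obtain U V where UV: "U + V = S"
    "card (subsums n U) + card (subsums n V) \<ge> 2 + size S"
    by (auto simp: subsums_empty)
  have "card (subsums n U) = nat n"
    using UV(2) size card_subsums_le[OF assms(1), of U] card_subsums_le[OF assms(1), of V] by simp
  then have "subsums n U = {0..<n}"
    using card_subset_eq[OF _ subsums_subset[OF assms(1), of U]] by simp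
  then have "1 mod n \<in> subsums n U" using assms(1) by simp
  then obtain T where T: "T \<subseteq># U" "sum_mset T mod n = 1 mod n" by (auto simp: subsums_def)
  have "e dvd z" if "z \<in># T" for z
  proof -
    have "z \<in># S" using that T(1) UV(1) by (metis mset_subset_eqD union_iff)
    then have "n dvd z - g \<or> n dvd z + g"
      using terms_equal_up_to_sign[OF assms(1) primes S nz size] assms(6) by blast
    then have "e dvd z - g \<or> e dvd z + g" using e(2) dvd_trans by blast
    then show ?thesis using e(1) by (simp add: dvd_add_left_iff dvd_diff_left_iff)
  qed
  then have "e dvd sum_mset T" by (induction T) auto
  moreover have "e dvd sum_mset T - 1" using T(2) e(2) by (metis mod_eq_dvd_iff dvd_trans)
  ultimately have "e dvd sum_mset T - (sum_mset T - 1)" by (rule dvd_diff)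
  then show "is_unit e" by simp
qed

section \<open>From congruences modulo \<open>n\<close> to congruences modulo
  \<open>n * k\<close>\<close>

text \<open>Exchange argument: one subsequence of the other terms completes both \<open>x\<close>
  and \<open>y\<close> to zero-sums modulo \<open>n\<close>; both sums are then divisible by
  \<open>n * k\<close>, and so is their difference \<open>x - y\<close>.\<close>

lemma congruent_terms_lift:
  fixes n k :: int
  assumes "n \<ge> 3" and primes: "\<And>p. prime p \<Longrightarrow> p dvd n \<Longrightarrow> p dvd k"
    and S: "zero_lifting n k S" and nz: "\<forall>x\<in>#S. \<not> n dvd x" and size: "size S + 2 = 2 * nat n"
    and xy: "x \<in># S" "y \<in># S" and cong: "[x = y] (mod n)"
  shows "[x = y] (mod n * k)"
proof (cases "x = y")
  case False
  have n: "n > 0" using assms by simp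
  define R where "R = S - {#x, y#}"
  have R: "S = add_mset x (add_mset y R)"
    using subset_mset.add_diff_inverse[OF pair_subset_mset[OF xy False]] by (simp add: R_def)
  have "{#} + {#} + R \<subseteq># S" unfolding R by (simp add: subset_mset.le_iff_add)
  from subsums_growth[OF n primes S nz this] obtain U V where UV: "U + V = R"
    "card (subsums n U) + card (subsums n V) \<ge> 2 + size R"
    by (auto simp: subsums_empty)
  have "size R + 4 = 2 * nat n" using size R by simp
  \<comment> \<open>The lower bound is \<open>2 * n - 2\<close>, which exceeds \<open>n\<close>
    because \<open>n \<ge> 3\<close>.\<close>
  then have big: "card (subsums n U) + card (subsums n V) > nat n" using UV(2) assms(1) by linarith
  \<comment> \<open>by pigeonhole, \<open>- x\<close> is a subset sum of \<open>R\<close>, which completes \<open>x\<close> as well as \<open>y\<close> to a zero-sum\<close>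
  define f where "f r = (- x - r) mod n" for r
  have "inj_on f (subsums n V)"
  proof (rule inj_onI)
    fix r s assume "r \<in> subsums n V" "s \<in> subsums n V" and eq: "f r = f s"
    then have rs: "r \<in> {0..<n}" "s \<in> {0..<n}" using subsums_subset[OF n, of V] by blast+
    have "n dvd (- x - r) - (- x - s)" using eq unfolding f_def by (rule mod_eq_dvd_iff[THEN iffD1])
    then have "n dvd s - r" by simp
    then have "s mod n = r mod n" by (rule mod_eq_dvd_iff[THEN iffD2])
    then show "r = s" using rs by simp
  qed
  then have "card (f ` subsums n V) = card (subsums n V)" by (rule card_image)
  moreover have "subsums n U \<union> f ` subsums n V \<subseteq> {0..<n}"
    using subsums_subset[OF n] n by (auto simp: f_def)
  then have "card (subsums n U \<union> f ` subsums n V) \<le> nat n"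
    using card_mono[of "{0..<n}"] by fastforce
  ultimately have "subsums n U \<inter> f ` subsums n V \<noteq> {}"
    using big card_Un_disjoint[of "subsums n U" "f ` subsums n V"] finite_subsums[OF n] by fastforce
  then obtain T W where TW: "T \<subseteq># U" "W \<subseteq># V" "(- x - sum_mset W mod n) mod n = sum_mset T mod n"
    by (auto simp: f_def subsums_def)
  have "n dvd (- x - sum_mset W) - sum_mset T" using TW(3) by (simp add: mod_simps mod_eq_dvd_iff)
  also have "(- x - sum_mset W) - sum_mset T = - (x + sum_mset (T + W))" by simp
  finally have "n dvd x + sum_mset (T + W)" by (simp only: dvd_minus_iff)
  moreover from this have "n dvd y + sum_mset (T + W)"
    using cong by (metis cong_add_rcancel cong_dvd_iff)
  moreover have TWR: "T + W \<subseteq># R" using TW UV(1) by (metis subset_mset.add_mono)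
  then have "add_mset x (T + W) \<subseteq># S" "add_mset y (T + W) \<subseteq># S"
    unfolding R by (auto simp: add_mset_commute[of x y] intro: subset_mset.order_trans)
  ultimately have "n * k dvd x + sum_mset (T + W)" "n * k dvd y + sum_mset (T + W)"
    using zero_liftingD[OF S] by fastforce+
  then have "n * k dvd (x + sum_mset (T + W)) - (y + sum_mset (T + W))" by (rule dvd_diff)
  then show ?thesis by (simp add: cong_iff_dvd_diff)
qed simp

lemma sum_mset_cong_const:
  fixes h n :: int
  assumes "\<forall>x\<in>#M. [x = h] (mod n)"
  shows "[sum_mset M = int (size M) * h] (mod n)"
  using assms
proof (induction M)
  case (add x M)
  then have "[x + sum_mset M = h + int (size M) * h] (mod n)" by (simp add: cong_add)
  then show ?case by (simp add: algebra_simps)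
qed simp

text \<open>Any \<open>n\<close> such terms would all agree with one term \<open>x\<close> modulo
  \<open>n * k\<close>, so their sum would be \<open>n * x\<close> there. Lifting then forces
  \<open>k dvd x\<close>, against the coprimality of \<open>x\<close> and \<open>n\<close>, since
  the primes of \<open>n\<close> divide \<open>k\<close>.\<close>

lemma size_congruent_terms_less:
  fixes n k :: int
  assumes "n \<ge> 3" and primes: "\<And>p. prime p \<Longrightarrow> p dvd n \<Longrightarrow> p dvd k"
    and S: "zero_lifting n k S" and nz: "\<forall>x\<in>#S. \<not> n dvd x" and size: "size S + 2 = 2 * nat n"
    and M: "M \<subseteq># S" "\<forall>x\<in>#M. [x = h] (mod n)"
  shows "size M < nat n"
proof (rule ccontr)
  assume "\<not> ?thesis"
  then have "size M \<ge> nat n" by simp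
  then have "M \<noteq> {#}" using assms(1) by auto
  then obtain x where x: "x \<in># M" by blast
  then have xS: "x \<in># S" using M(1) by (meson mset_subset_eqD)
  have lift: "[y = x] (mod n * k)" if "y \<in># M" for y
  proof (rule congruent_terms_lift[OF assms(1) primes S nz size _ xS])
    show "y \<in># S" using that M(1) by (meson mset_subset_eqD)
    show "[y = x] (mod n)" using M(2) that x by (meson cong_sym cong_trans)
  qed
  obtain N where N: "N \<subseteq># M" "size N = nat n"
  proof -
    obtain xs where xs: "M = mset xs" by (metis ex_mset)
    then have "mset (take (nat n) xs) \<subseteq># M"
      by (metis append_take_drop_id mset_append mset_subset_eq_add_left)
    then show ?thesis using that[of "mset (take (nat n) xs)"] \<open>size M \<ge> nat n\<close> xs by simp
  qed
  have "\<forall>y\<in>#N. [y = x] (mod n * k)" using N(1) lift by (meson mset_subset_eqD)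
  then have cong: "[sum_mset N = n * x] (mod n * k)"
    using sum_mset_cong_const[of N x "n * k"] N(2) assms(1) by simp
  then have "n dvd sum_mset N" by (meson cong_dvd_iff cong_dvd_modulus dvd_triv_left)
  moreover have "N \<subseteq># S" using N(1) M(1) by (meson subset_mset.order_trans)
  ultimately have "n * k dvd n * x" using zero_liftingD[OF S] cong by (meson cong_dvd_iff)
  then have "k dvd x" using assms(1) by simp
  have "n > 0" "\<bar>n\<bar> \<noteq> 1" using assms(1) by auto
  then obtain p where p: "prime p" "p dvd n" using prime_divisor_exists[of n] by auto
  then have "p dvd x" using primes \<open>k dvd x\<close> dvd_trans by blast
  moreover have "coprime x n" using terms_coprime[OF \<open>n > 0\<close> primes S nz size xS] .
  ultimately show False using p by (meson coprime_common_divisor not_prime_unit)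
qed

section \<open>Structure of the extremal sequences and its converse\<close>

text \<open>For \<open>n \<ge> 3\<close> the classes of \<open>g\<close> and \<open>- g\<close>
  modulo \<open>n\<close> have at most \<open>n - 1\<close> terms each and share
  \<open>2 * n - 2\<close> terms, so both are full. The first lifts by exchange; a term
  \<open>x\<close> of the second lifts because \<open>x + g\<close> is a zero-sum.\<close>

lemma zero_lifting_structure:
  fixes n k :: int
  assumes "n \<ge> 2" and primes: "\<And>p. prime p \<Longrightarrow> p dvd n \<Longrightarrow> p dvd k"
    and S: "zero_lifting n k S" and nz: "\<forall>x\<in>#S. \<not> n dvd x" and size: "size S + 2 = 2 * nat n"
  obtains g A B where "coprime g n" "S = A + B" "size A = nat n - 1" "size B = nat n - 1"
    "\<forall>x\<in>#A. [x = g] (mod n * k)" "\<forall>x\<in>#B. [x = - g] (mod n * k)"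
proof -
  have n: "n > 0" using assms by simp
  have "S \<noteq> {#}" using size assms(1) by auto
  then obtain g where g: "g \<in># S" by blast
  have cop: "coprime g n" using terms_coprime[OF n primes S nz size g] .
  show ?thesis
  proof (cases "n = 2")
    case True
    then have "size S = 2" using size by simp
    then obtain h where h: "S = {#g, h#}"
      using g by (metis insert_DiffM size_add_mset size_1_singleton_mset nat.inject numeral_2_eq_2 One_nat_def)
    then have "n dvd g - h \<or> n dvd g + h"
      using terms_equal_up_to_sign[OF n primes S nz size g, of h] by simp
    then have "n dvd sum_mset S" using True h by auto
    then have "n * k dvd h - (- g)" using zero_liftingD[OF S, of S] h by (simp add: add.commute)
    then have "[h = - g] (mod n * k)" by (simp only: cong_iff_dvd_diff)
    then show ?thesis using that[of g "{#g#}" "{#h#}"] cop h True by simp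
  next
    case False
    then have n3: "n \<ge> 3" using assms(1) by simp
    define A where "A = filter_mset (\<lambda>x. [x = g] (mod n)) S"
    define B where "B = filter_mset (\<lambda>x. \<not> [x = g] (mod n)) S"
    have AB: "S = A + B" unfolding A_def B_def by (rule multiset_partition)
    have Bneg: "[x = - g] (mod n)" if "x \<in># B" for x
      using that terms_equal_up_to_sign[OF n primes S nz size _ g, of x]
      by (auto simp: B_def cong_iff_dvd_diff)
    have "size A < nat n"
      by (rule size_congruent_terms_less[OF n3 primes S nz size, of _ g]) (auto simp: A_def)
    moreover have "size B < nat n"
      by (rule size_congruent_terms_less[OF n3 primes S nz size, of _ "- g"]) (auto simp: AB Bneg)
    moreover have "size A + size B + 2 = 2 * nat n" using size AB by simp
    ultimately have sizes: "size A = nat n - 1" "size B = nat n - 1" by auto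
    have "[x = g] (mod n * k)" if "x \<in># A" for x
      by (rule congruent_terms_lift[OF n3 primes S nz size _ g]) (use that in \<open>auto simp: A_def\<close>)
    moreover have "[x = - g] (mod n * k)" if "x \<in># B" for x
    proof -
      have "x \<noteq> g" "x \<in># S" using that by (auto simp: B_def)
      then have sub: "{#x, g#} \<subseteq># S" using g by (intro pair_subset_mset)
      have "n dvd x - (- g)" using Bneg[OF that] by (simp only: cong_iff_dvd_diff)
      then have "n * k dvd sum_mset {#x, g#}" by (intro zero_liftingD[OF S sub]) simp
      then have "n * k dvd x - (- g)" by simp
      then show ?thesis by (simp only: cong_iff_dvd_diff)
    qed
    ultimately show ?thesis using that cop AB sizes by blast
  qed
qed

text \<open>With \<open>a\<close> terms from \<open>A\<close> and \<open>b\<close> from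
  \<open>B\<close> the sum is \<open>(a - b) * g\<close> modulo \<open>n * k\<close>. Divisibility
  by \<open>n\<close> gives \<open>n dvd a - b\<close>, as \<open>g\<close> is coprime to
  \<open>n\<close>, and the size bounds force \<open>a = b\<close>.\<close>

lemma zero_lifting_if_structure:
  fixes n k g :: int
  assumes "n > 0" "coprime g n" and size: "size A < nat n" "size B < nat n"
    and A: "\<forall>x\<in>#A. [x = g] (mod n * k)" and B: "\<forall>x\<in>#B. [x = - g] (mod n * k)"
  shows "zero_lifting n k (A + B)"
  unfolding zero_lifting_def
proof (intro allI impI)
  fix T assume T: "T \<subseteq># A + B" "n dvd sum_mset T"
  define X where "X = T \<inter># A"
  define Y where "Y = T - A"
  have XY: "T = X + Y" "X \<subseteq># A" "Y \<subseteq># B"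
    using T(1) unfolding X_def Y_def
    by (auto simp: multiset_eq_iff subset_eq_diff_conv add.commute)
  have "[sum_mset X = int (size X) * g] (mod n * k)" "[sum_mset Y = int (size Y) * - g] (mod n * k)"
    using XY A B by (meson mset_subset_eqD sum_mset_cong_const)+
  then have "[sum_mset X + sum_mset Y = int (size X) * g + int (size Y) * - g] (mod n * k)"
    by (rule cong_add)
  then have cong: "[sum_mset T = (int (size X) - int (size Y)) * g] (mod n * k)"
    using XY(1) by (simp add: algebra_simps)
  then have "n dvd (int (size X) - int (size Y)) * g"
    using T(2) by (meson cong_dvd_iff cong_dvd_modulus dvd_triv_left)
  then have "n dvd int (size X) - int (size Y)"
    using assms(2) by (simp add: coprime_dvd_mult_left_iff coprime_commute)
  moreover have "\<bar>int (size X) - int (size Y)\<bar> < n"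
    using size size_mset_mono[OF XY(2)] size_mset_mono[OF XY(3)] by linarith
  ultimately have "int (size X) - int (size Y) = 0"
    using zdvd_not_zless[of "\<bar>int (size X) - int (size Y)\<bar>" n] by fastforce
  then show "n * k dvd sum_mset T" using cong by (simp add: cong_0_iff)
qed

section \<open>Radicals, and the parametrization by \<open>c\<close> and \<open>d\<close>\<close>

lemma prime_dvd_rad_iff:
  assumes "n > 0" "prime p"
  shows "p dvd rad n \<longleftrightarrow> p dvd n"
proof -
  have "p dvd rad n \<longleftrightarrow> (\<exists>q\<in>prime_factors n. p dvd q)"
    unfolding rad_def using assms(2) by (intro prime_dvd_prod_iff) auto
  also have "\<dots> \<longleftrightarrow> p dvd n"
  proof
    assume "p dvd n"
    then have "p \<in> prime_factors n" using assms by (simp add: in_prime_factors_iff)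
    then show "\<exists>q\<in>prime_factors n. p dvd q" by (intro bexI[of _ p]) simp_all
  next
    assume "\<exists>q\<in>prime_factors n. p dvd q"
    then obtain q where "q \<in> prime_factors n" "p dvd q" by blast
    then show "p dvd n" using dvd_trans[of p q n] by (simp add: in_prime_factors_iff)
  qed
  finally show ?thesis .
qed

theorem theorem1p3:
  fixes n k m :: nat and S :: "int multiset"
  assumes "n > 0" and "k > 0" and "m > 0"
    and "m dvd k" and "gcd m (k div m) = 1"
    and "rad (k div m) = rad n" and "rad n > 1"
    and "size S = 2 * n - 2"
    and "\<forall>x\<in>#S. \<not> int n dvd x"
  shows
    "((\<nexists>T. T \<subseteq># S \<and> size T \<le> n \<and> int n dvd sum_mset T \<and> \<not> int (n * k) dvd sum_mset T)
       \<longleftrightarrow>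
      (\<exists>c d :: int. coprime c (int n) \<and>
        (\<exists>A B. S = A + B \<and> size A = n - 1 \<and> size B = n - 1 \<and>
          (\<forall>x\<in>#A. [x = d * int (n * k div m) + c * int m] (mod int (n * k))) \<and>
          (\<forall>x\<in>#B. [x = - d * int (n * k div m) - c * int m] (mod int (n * k))))))
     \<and>
     ((\<exists>c d :: int. coprime c (int n) \<and>
        (\<exists>A B. S = A + B \<and> size A = n - 1 \<and> size B = n - 1 \<and>
          (\<forall>x\<in>#A. [x = d * int (n * k div m) + c * int m] (mod int (n * k))) \<and>
          (\<forall>x\<in>#B. [x = - d * int (n * k div m) - c * int m] (mod int (n * k)))))
       \<longrightarrow>
      (\<nexists>T. T \<subseteq># S \<and> int n dvd sum_mset T \<and> \<not> int (n * k) dvd sum_mset T))"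
proof -
  let ?q = "k div m"
  have k: "k = ?q * m" using assms(4) by simp
  then have q: "?q > 0" using assms(2) by (metis mult_0 neq0_conv)
  have primes_q: "p dvd ?q \<longleftrightarrow> p dvd n" if "prime p" for p
    using prime_dvd_rad_iff[OF q that] prime_dvd_rad_iff[OF assms(1) that] assms(6) by simp
  have primes: "p dvd int k" if "prime p" "p dvd int n" for p :: int
  proof -
    have "prime (nat p)" "p = int (nat p)" using that(1) by (auto simp: prime_ge_0_int)
    then have "nat p dvd ?q" using primes_q that(2) by (metis int_dvd_int_iff)
    then have "nat p dvd k" using k by (metis dvd_mult2)
    then show ?thesis using \<open>p = int (nat p)\<close> by (metis int_dvd_int_iff)
  qed
  have "n \<noteq> 1" using assms(7) by (auto simp: rad_def)
  then have n2: "n \<ge> 2" using assms(1) by simp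
  have n2': "int n \<ge> 2" using n2 by simp
  have size: "size S + 2 = 2 * nat (int n)" using assms(8) n2 by simp
  \<comment> \<open>A common prime of \<open>n\<close> and \<open>m\<close> would also divide
    \<open>k div m\<close>, because the radicals agree.\<close>
  have cop: "coprime n m"
  proof (rule ccontr)
    assume "\<not> coprime n m"
    then obtain p where p: "prime p" "p dvd n" "p dvd m"
      by (metis prime_factor_nat coprime_iff_gcd_eq_1 gcd_dvd1 gcd_dvd2 dvd_trans)
    then have "p dvd gcd m ?q" using primes_q by simp
    then show False using assms(5) p(1) by simp
  qed
  have nk: "int (n * k) = int n * int k" by simp
  have quot: "n * k div m = n * ?q" using assms(4) by (simp add: div_mult_swap)
  \<comment> \<open>The bounded and the unbounded condition both amount to
    \<open>zero_lifting\<close>, so the claim about subsequences of any length follows from the same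
    equivalence.\<close>
  have short_iff: "(\<nexists>T. T \<subseteq># S \<and> size T \<le> n \<and> int n dvd sum_mset T \<and> \<not> int (n * k) dvd sum_mset T)
      \<longleftrightarrow> zero_lifting (int n) (int k) S" (is "?short \<longleftrightarrow> _")
    using zero_lifting_if_short[OF assms(1), of S k] by (auto simp: zero_lifting_def)
  have all_iff: "(\<nexists>T. T \<subseteq># S \<and> int n dvd sum_mset T \<and> \<not> int (n * k) dvd sum_mset T)
      \<longleftrightarrow> zero_lifting (int n) (int k) S"
    by (auto simp: zero_lifting_def)
  let ?struct = "\<exists>c d :: int. coprime c (int n) \<and>
        (\<exists>A B. S = A + B \<and> size A = n - 1 \<and> size B = n - 1 \<and>
          (\<forall>x\<in>#A. [x = d * int (n * k div m) + c * int m] (mod int (n * k))) \<and>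
          (\<forall>x\<in>#B. [x = - d * int (n * k div m) - c * int m] (mod int (n * k))))"
  have "?struct" if lift: "zero_lifting (int n) (int k) S"
  proof -
    obtain g A B where g: "coprime g (int n)" and AB: "S = A + B"
      "size A = nat (int n) - 1" "size B = nat (int n) - 1"
      "\<forall>x\<in>#A. [x = g] (mod int n * int k)" "\<forall>x\<in>#B. [x = - g] (mod int n * int k)"
      by (rule zero_lifting_structure[OF n2' primes lift assms(9) size])
    have "coprime ?q m" using assms(5) by (simp only: coprime_iff_gcd_eq_1 gcd.commute)
    then have "coprime (int n * int ?q) (int m)"
      using cop by (simp only: coprime_int_iff coprime_mult_left_iff flip: of_nat_mult)
    \<comment> \<open>Scaling these Bezout coefficients by \<open>g\<close> yields \<open>d\<close>
      and \<open>c\<close>, so \<open>g\<close> acquires the required form exactly.\<close>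
    then obtain v u where uv: "v * (int n * int ?q) + u * int m = 1"
      using bezout_int[of "int n * int ?q" "int m"] unfolding coprime_iff_gcd_eq_1 by metis
    define c where "c = g * u"
    define d where "d = g * v"
    have "d * (int n * int ?q) + c * int m = g * (v * (int n * int ?q) + u * int m)"
      by (simp add: c_def d_def algebra_simps)
    then have eq: "d * (int n * int ?q) + c * int m = g" using uv by simp
    then have eq1: "d * int (n * k div m) + c * int m = g" by (simp add: quot)
    then have eq2: "- d * int (n * k div m) - c * int m = - g" by simp
    have "coprime c (int n)"
    proof (rule coprimeI)
      fix e assume "e dvd c" "e dvd int n"
      then have "e dvd d * (int n * int ?q) + c * int m" by (simp add: dvd_add)
      then have "e dvd g" unfolding eq .
      then show "is_unit e" using g \<open>e dvd int n\<close> by (meson coprime_common_divisor)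
    qed
    moreover have "\<forall>x\<in>#A. [x = d * int (n * k div m) + c * int m] (mod int (n * k))"
      unfolding nk eq1 by (rule AB(4))
    moreover have "\<forall>x\<in>#B. [x = - d * int (n * k div m) - c * int m] (mod int (n * k))"
      unfolding nk eq2 by (rule AB(5))
    ultimately show ?thesis using AB(1-3) unfolding nat_int by blast
  qed
  moreover have "zero_lifting (int n) (int k) S" if ?struct
  proof -
    from that obtain c d :: int and A B where c: "coprime c (int n)"
      and AB: "S = A + B" "size A = n - 1" "size B = n - 1"
        "\<forall>x\<in>#A. [x = d * int (n * k div m) + c * int m] (mod int (n * k))"
        "\<forall>x\<in>#B. [x = - d * int (n * k div m) - c * int m] (mod int (n * k))"
      by blast
    define g where "g = d * int (n * k div m) + c * int m"
    \<comment> \<open>Modulo \<open>n\<close> only \<open>c * m\<close> remains of \<open>g\<close>,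
      a product of two factors coprime to \<open>n\<close>.\<close>
    have "g = c * int m + int n * (d * int ?q)" by (simp add: g_def quot)
    moreover have "coprime (c * int m) (int n)" using c cop by (simp add: coprime_commute)
    ultimately have "coprime g (int n)"
      by (metis coprime_iff_gcd_eq_1 gcd.commute gcd_add_mult mult.commute add.commute)
    moreover have "- d * int (n * k div m) - c * int m = - g" by (simp add: g_def)
    ultimately show ?thesis
      unfolding AB(1) using zero_lifting_if_structure[of "int n" g A B "int k"] AB n2
      by (simp add: g_def)
  qed
  ultimately show ?thesis unfolding short_iff all_iff by blast
qed

end
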